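(* Let $G=\langle V,E\rangle$ be a finite undirected graph without isolated vertices, and for $v\in V$ let $N[v]$ denote the closed neighbourhood of $v$ (the set consisting of $v$ and all vertices joined to $v$ by an edge). Assign to each vertex $v$ a value $h(v)$ by one of the following two methods: (i) (random reals method) the values $h(v)$, $v\in V$, are independent random reals, each uniformly distributed on $[0,1]$; (ii) (finite fields method) $V\subseteq\mathbb{F}$ for a finite field $\mathbb{F}$ equipped with an arbitrary fixed total order; elements $A\in\mathbb{F}\setminus\{0\}$ and $B\in\mathbb{F}$ are chosen uniformly at random, and $h(v)=A\cdot v+B$ (computed in $\mathbb{F}$), values being compared with respect to the fixed total order on $\mathbb{F}$. For each vertex $v$ let its representative be $r(v)=\operatorname{argmin}_{w\in N[v]} h(w)$. Then the expected number of distinct vertices chosen as representatives, $\mathbb{E}\,|\{r(v)\mid v\in V\}|$, is at most $\tfrac34|V|$.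
   Context: In method (ii), $h$ is a bijection of $\mathbb{F}$, so the argmin is unique; in method (i) ties occur with probability zero. *)

theory Defs
  imports "HOL-Algebra.Ring" "HOL-Probability.Probability"
begin

definition finite_simple_graph :: "'a set \<Rightarrow> 'a set set \<Rightarrow> bool" where
  "finite_simple_graph V E \<longleftrightarrow> finite V \<and> (\<forall>e\<in>E. e \<subseteq> V \<and> card e = 2)"

definition no_isolated_vertices :: "'a set \<Rightarrow> 'a set set \<Rightarrow> bool" where
  "no_isolated_vertices V E \<longleftrightarrow> (\<forall>v\<in>V. \<exists>e\<in>E. v \<in> e)"

definition closed_nbhd :: "'a set set \<Rightarrow> 'a \<Rightarrow> 'a set" where
  "closed_nbhd E v = insert v {w. {v, w} \<in> E}"

(* The strict order lt on the values is an explicit argument because finite fields carry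
   no canonical order. In case of ties, the library's arg_min_on selects one of the
   minimisers, and the choice depends only on the set of minimisers. *)

definition representative ::
  "('b \<Rightarrow> 'b \<Rightarrow> bool) \<Rightarrow> 'a set set \<Rightarrow> ('a \<Rightarrow> 'b) \<Rightarrow> 'a \<Rightarrow> 'a" where
  "representative lt E h v = ord.arg_min_on lt h (closed_nbhd E v)"

definition num_representatives ::
  "('b \<Rightarrow> 'b \<Rightarrow> bool) \<Rightarrow> 'a set \<Rightarrow> 'a set set \<Rightarrow> ('a \<Rightarrow> 'b) \<Rightarrow> nat" where
  "num_representatives lt V E h = card (representative lt E h ` V)"

end

theory Submission
  imports Defs
begin

text \<open>
  Split the values at their median into a low half and a high half, and fix a neighbour
  \<open>p w\<close> of every vertex \<open>w\<close>. If a representative \<open>v = r(w)\<close> has a high value, then all of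
  \<open>N[w]\<close>, in particular both \<open>w\<close> and \<open>p w\<close>, have high values, and distinct such \<open>v\<close> come from
  distinct \<open>w\<close>. Hence the number of representatives is at most the number of low vertices plus
  the number of \<open>w\<close> for which \<open>w\<close> and \<open>p w\<close> are both high. Pairwise independence makes the
  expectation at most \<open>|V|/2 + |V|/4\<close>; in the finite field the values are distinct, which only
  lowers the second term.
\<close>

section \<open>Closed neighbourhoods and minimality of representatives\<close>

lemma closed_nbhd_subset:
  assumes "finite_simple_graph V E" "v \<in> V"
  shows "closed_nbhd E v \<subseteq> V"
  using assms by (auto simp: closed_nbhd_def finite_simple_graph_def)

text \<open>An edge has exactly two elements, so an edge at \<open>v\<close> contains a second
  vertex. This supplies the partner \<open>p v\<close>.\<close>

lemma ex_neighbour: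
  assumes "finite_simple_graph V E" "no_isolated_vertices V E" "v \<in> V"
  shows "\<exists>w\<in>V. w \<noteq> v \<and> w \<in> closed_nbhd E v"
proof -
  obtain e where e: "e \<in> E" "v \<in> e" "e \<subseteq> V" "card e = 2"
    using assms by (auto simp: no_isolated_vertices_def finite_simple_graph_def)
  then obtain a b where ab: "e = {a, b}" "a \<noteq> b"
    by (auto simp: card_2_iff)
  show ?thesis
  proof (cases "v = a")
    case True
    then show ?thesis using e ab by (intro bexI[of _ b]) (auto simp: closed_nbhd_def)
  next
    case False
    then have "v = b" using e ab by auto
    then show ?thesis using e ab
      by (intro bexI[of _ a]) (auto simp: closed_nbhd_def insert_commute)
  qed
qed

text \<open>\<open>arg_min_on\<close> is a Hilbert choice, so its specification is available once
  some minimiser exists. One exists because the closed neighbourhood is finite and nonempty and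
  \<open>lt\<close>, pulled back along \<open>h\<close>, is transitive and asymmetric.\<close>

lemma representative_minimal:
  assumes G: "finite_simple_graph V E" and v: "v \<in> V"
    and tr: "transp lt" and irr: "irreflp lt"
  shows "representative lt E h v \<in> closed_nbhd E v"
    and "w \<in> closed_nbhd E v \<Longrightarrow> \<not> lt (h w) (h (representative lt E h v))"
proof -
  let ?N = "closed_nbhd E v" and ?r = "representative lt E h v"
  have fin: "finite ?N"
    using closed_nbhd_subset[OF G v] G finite_subset by (auto simp: finite_simple_graph_def)
  have "transp_on ?N (\<lambda>x y. lt (h x) (h y))"
    using tr by (auto simp: transp_on_def)
  moreover have "asymp_on ?N (\<lambda>x y. lt (h x) (h y))"
    using tr irr by (intro asymp_onI notI) (blast dest: transpD irreflpD)
  moreover have "?N \<noteq> {}"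
    by (simp add: closed_nbhd_def)
  ultimately obtain m where "m \<in> ?N" "\<forall>x\<in>?N. x \<noteq> m \<longrightarrow> \<not> lt (h x) (h m)"
    using Finite_Set.bex_min_element[OF fin] by blast
  then have "ord.is_arg_min lt h (\<lambda>x. x \<in> ?N) m"
    using irr by (auto simp: ord.is_arg_min_def dest: irreflpD)
  then have "ord.is_arg_min lt h (\<lambda>x. x \<in> ?N) ?r"
    unfolding representative_def ord.arg_min_on_def ord.arg_min_def by (rule someI)
  then show "?r \<in> ?N" "w \<in> ?N \<Longrightarrow> \<not> lt (h w) (h ?r)"
    by (auto simp: ord.is_arg_min_def)
qed

section \<open>The threshold bound, pointwise and in expectation\<close>

text \<open>Low representatives lie in the first set; high ones are images under the representative
  map of the second set, and an image is no larger than its source. Only minimality enters, so the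
  bound holds whichever minimiser is chosen at a tie. \<open>P\<close> (being low) stays abstract to
  cover both \<open>x < 1/2\<close> and membership in an initial segment of the field's
  order.\<close>

lemma num_representatives_le_threshold:
  assumes G: "finite_simple_graph V E" and p: "\<And>v. v \<in> V \<Longrightarrow> p v \<in> closed_nbhd E v"
    and tr: "transp lt" and irr: "irreflp lt"
    and sep: "\<And>u v. u \<in> V \<Longrightarrow> v \<in> V \<Longrightarrow> P (h u) \<Longrightarrow> \<not> P (h v) \<Longrightarrow> lt (h u) (h v)"
  shows "num_representatives lt V E h
    \<le> card {v \<in> V. P (h v)} + card {v \<in> V. \<not> P (h v) \<and> \<not> P (h (p v))}"
proof -
  let ?r = "representative lt E h"
  let ?L = "{v \<in> V. P (h v)}" and ?H = "{v \<in> V. \<not> P (h v) \<and> \<not> P (h (p v))}"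
  have fin: "finite V"
    using G by (simp add: finite_simple_graph_def)
  have sub: "closed_nbhd E v \<subseteq> V" if "v \<in> V" for v
    using closed_nbhd_subset[OF G that] .
  have "?r v \<in> ?L \<union> ?r ` ?H" if v: "v \<in> V" for v
  proof (cases "P (h (?r v))")
    case True
    then show ?thesis
      using sub[OF v] representative_minimal(1)[OF G v tr irr] by auto
  next
    case False
    \<comment> \<open>A low \<open>w\<close> in the neighbourhood would, by \<open>sep\<close>, have
      a value strictly below that of the high representative.\<close>
    have "\<not> P (h w)" if "w \<in> closed_nbhd E v" for w
      using sep[of w "?r v"] sub[OF v] representative_minimal[OF G v tr irr] that False by blast
    then have "v \<in> ?H"
      using p[OF v] v by (auto simp: closed_nbhd_def)
    then show ?thesis by blast
  qed
  then have "card (?r ` V) \<le> card (?L \<union> ?r ` ?H)"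
    using fin by (intro card_mono) auto
  also have "\<dots> \<le> card ?L + card (?r ` ?H)"
    by (rule card_Un_le)
  also have "card (?r ` ?H) \<le> card ?H"
    using fin by (intro card_image_le) auto
  finally show ?thesis
    by (simp add: num_representatives_def)
qed

text \<open>Linearity of expectation applied to the pointwise bound, with both cardinalities written
  as sums of indicators. Each randomisation method then only has to supply the estimate
  \<open>le\<close> for a single vertex and its partner. \<open>sep\<close> is required almost
  surely because in the field case values are controlled only on the support of the
  distribution.\<close>

lemma (in prob_space) expectation_num_representatives_le:
  assumes G: "finite_simple_graph V E" and p: "\<And>v. v \<in> V \<Longrightarrow> p v \<in> closed_nbhd E v"
    and tr: "transp lt" and irr: "irreflp lt"
    and sep: "AE \<omega> in M. \<forall>u\<in>V. \<forall>v\<in>V. P (X u \<omega>) \<and> \<not> P (X v \<omega>) \<longrightarrow> lt (X u \<omega>) (X v \<omega>)"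
    and int: "integrable M (\<lambda>\<omega>. real (num_representatives lt V E (\<lambda>v. X v \<omega>)))"
    and low: "\<And>v. v \<in> V \<Longrightarrow> {\<omega> \<in> space M. P (X v \<omega>)} \<in> events"
    and le: "\<And>v. v \<in> V \<Longrightarrow> prob {\<omega> \<in> space M. P (X v \<omega>)}
      + prob {\<omega> \<in> space M. \<not> P (X v \<omega>) \<and> \<not> P (X (p v) \<omega>)} \<le> c"
  shows "expectation (\<lambda>\<omega>. real (num_representatives lt V E (\<lambda>v. X v \<omega>))) \<le> c * real (card V)"
proof -
  let ?A = "\<lambda>v. {\<omega> \<in> space M. P (X v \<omega>)}"
  let ?B = "\<lambda>v. {\<omega> \<in> space M. \<not> P (X v \<omega>) \<and> \<not> P (X (p v) \<omega>)}"
  let ?I = "\<lambda>v \<omega>. indicator (?A v) \<omega> + indicator (?B v) \<omega> :: real"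
  have fin: "finite V"
    using G by (simp add: finite_simple_graph_def)
  have pV: "p v \<in> V" if "v \<in> V" for v
    using p[OF that] closed_nbhd_subset[OF G that] by blast
  have high: "?B v \<in> events" if "v \<in> V" for v
  proof -
    have "?B v = space M - ?A v - ?A (p v)" by auto
    then show ?thesis using low[OF that] low[OF pV[OF that]] by auto
  qed
  have "real (num_representatives lt V E (\<lambda>v. X v \<omega>)) \<le> (\<Sum>v\<in>V. ?I v \<omega>)"
    if \<omega>: "\<omega> \<in> space M"
      and sep\<omega>: "\<forall>u\<in>V. \<forall>v\<in>V. P (X u \<omega>) \<and> \<not> P (X v \<omega>) \<longrightarrow> lt (X u \<omega>) (X v \<omega>)" for \<omega>
  proof -
    have "num_representatives lt V E (\<lambda>v. X v \<omega>)
      \<le> card {v \<in> V. P (X v \<omega>)} + card {v \<in> V. \<not> P (X v \<omega>) \<and> \<not> P (X (p v) \<omega>)}"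
      using sep\<omega> by (intro num_representatives_le_threshold[OF G p tr irr]) auto
    then have "real (num_representatives lt V E (\<lambda>v. X v \<omega>))
      \<le> real (card {v \<in> V. P (X v \<omega>)})
        + real (card {v \<in> V. \<not> P (X v \<omega>) \<and> \<not> P (X (p v) \<omega>)})"
      by linarith
    also have "\<dots> = (\<Sum>v\<in>V. ?I v \<omega>)"
      using fin \<omega> by (simp add: sum.distrib indicator_def sum.If_cases Int_def)
    finally show ?thesis .
  qed
  with sep have "AE \<omega> in M. real (num_representatives lt V E (\<lambda>v. X v \<omega>)) \<le> (\<Sum>v\<in>V. ?I v \<omega>)"
    by (auto elim!: AE_mp)
  moreover have I: "integrable M (indicat_real (?A v))" "integrable M (indicat_real (?B v))"
    if "v \<in> V" for v
    using low[OF that] high[OF that]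
    by (auto intro!: integrable_real_indicator simp: less_top[symmetric])
  ultimately have "expectation (\<lambda>\<omega>. real (num_representatives lt V E (\<lambda>v. X v \<omega>)))
      \<le> expectation (\<lambda>\<omega>. \<Sum>v\<in>V. ?I v \<omega>)"
    using int by (intro integral_mono_AE Bochner_Integration.integrable_sum
        Bochner_Integration.integrable_add) auto
  also have "\<dots> = (\<Sum>v\<in>V. expectation (?I v))"
    by (intro Bochner_Integration.integral_sum Bochner_Integration.integrable_add I)
  also have "\<dots> = (\<Sum>v\<in>V. prob (?A v) + prob (?B v))"
  proof (rule sum.cong[OF refl])
    fix v assume "v \<in> V"
    then have "expectation (?I v) = expectation (indicat_real (?A v)) + expectation (indicat_real (?B v))"
      by (intro Bochner_Integration.integral_add I)
    also have "\<dots> = prob (?A v) + prob (?B v)"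
    proof -
      have "?A v \<inter> space M = ?A v" "?B v \<inter> space M = ?B v"
        by auto
      then show ?thesis
        by (simp only: Bochner_Integration.integral_indicator)
    qed
    finally show "expectation (?I v) = prob (?A v) + prob (?B v)" .
  qed
  also have "\<dots> \<le> (\<Sum>v\<in>V. c)"
    by (intro sum_mono le)
  finally show ?thesis
    by (simp add: mult.commute)
qed

section \<open>Measurability of the number of representatives\<close>

text \<open>The count depends on \<open>h\<close> only through the comparisons between vertices of
  \<open>V\<close>, a finite amount of information. The two sides have the same minimiser
  predicates, so Hilbert choice returns the same vertex, even at ties.\<close>

lemma num_representatives_cong:
  assumes "finite_simple_graph V E"
  shows "num_representatives lt V E h
    = num_representatives (\<lambda>u v. (u, v) \<in> {q \<in> V \<times> V. lt (h (fst q)) (h (snd q))}) V E id"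
  unfolding num_representatives_def
proof (intro arg_cong[where f = card] image_cong refl)
  fix v assume "v \<in> V"
  with assms have "closed_nbhd E v \<subseteq> V"
    by (rule closed_nbhd_subset)
  then show "representative lt E h v
    = representative (\<lambda>u v. (u, v) \<in> {q \<in> V \<times> V. lt (h (fst q)) (h (snd q))}) E id v"
    unfolding representative_def ord.arg_min_on_def ord.arg_min_def ord.is_arg_min_def
    by (intro arg_cong[where f = Eps] ext) auto
qed

text \<open>The count factors through the random comparison relation \<open>rel\<close>, which has
  finitely many possible values; each of its fibres is a finite conjunction of measurable
  comparisons.\<close>

lemma measurable_num_representatives:
  fixes X :: "'a \<Rightarrow> 'w \<Rightarrow> real"
  assumes G: "finite_simple_graph V E" and X: "\<And>v. v \<in> V \<Longrightarrow> X v \<in> borel_measurable M"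
  shows "(\<lambda>\<omega>. real (num_representatives (<) V E (\<lambda>v. X v \<omega>))) \<in> borel_measurable M"
proof -
  define rel where "rel \<omega> = {q \<in> V \<times> V. X (fst q) \<omega> < X (snd q) \<omega>}" for \<omega>
  have fin: "finite V"
    using G by (simp add: finite_simple_graph_def)
  have "rel \<in> measurable M (count_space (Pow (V \<times> V)))"
  proof (subst measurable_count_space_eq2)
    have eq_iff: "{q \<in> A. Q q} = R \<longleftrightarrow> (\<forall>q\<in>A. Q q = (q \<in> R))" if "R \<subseteq> A"
      for A R :: "('a \<times> 'a) set" and Q
      using that by blast
    have "rel -` {R} \<inter> space M \<in> sets M" if "R \<subseteq> V \<times> V" for R
    proof -
      have "rel -` {R} \<inter> space M
        = {\<omega> \<in> space M. \<forall>q\<in>V \<times> V. (X (fst q) \<omega> < X (snd q) \<omega>) = (q \<in> R)}"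
        unfolding vimage_def rel_def singleton_iff mem_Collect_eq eq_iff[OF that] by blast
      also have "\<dots> \<in> sets M"
      proof (rule sets.sets_Collect_finite_All)
        fix q assume q: "q \<in> V \<times> V"
        have [measurable]: "X (fst q) \<in> borel_measurable M" "X (snd q) \<in> borel_measurable M"
          using q X by auto
        show "{\<omega> \<in> space M. (X (fst q) \<omega> < X (snd q) \<omega>) = (q \<in> R)} \<in> sets M"
          by measurable
      qed (use fin in auto)
      finally show ?thesis .
    qed
    then show "rel \<in> space M \<rightarrow> Pow (V \<times> V) \<and> (\<forall>R\<in>Pow (V \<times> V). rel -` {R} \<inter> space M \<in> sets M)"
      by (auto simp: rel_def)
  qed (use fin in auto)
  \<comment> \<open>Every function on a \<open>count_space\<close> is measurable, so the Hilbert
    choice inside the count is harmless.\<close>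
  then have "(\<lambda>\<omega>. real (num_representatives (\<lambda>u v. (u, v) \<in> rel \<omega>) V E id)) \<in> borel_measurable M"
    by (rule measurable_compose) simp
  then show ?thesis
    unfolding rel_def by (subst num_representatives_cong[OF G])
qed

lemma num_representatives_le_card:
  assumes "finite_simple_graph V E"
  shows "num_representatives lt V E h \<le> card V"
  using assms by (auto simp: num_representatives_def finite_simple_graph_def intro: card_image_le)

section \<open>The random reals method\<close>

text \<open>The threshold is the median \<open>1/2\<close>: a vertex is low with probability
  \<open>1/2\<close>, and it and its partner are both high with probability \<open>1/4\<close>.
  Integrability follows from measurability and the bound \<open>card V\<close>.\<close>

lemma (in prob_space) num_representatives_uniform_reals:
  fixes X :: "'b \<Rightarrow> 'a \<Rightarrow> real"
  assumes G: "finite_simple_graph V E" and iso: "no_isolated_vertices V E"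
    and ind: "indep_vars (\<lambda>_. borel) X V"
    and unif: "\<And>v. v \<in> V \<Longrightarrow> distr M borel (X v) = uniform_measure lborel {0..1}"
  shows "integrable M (\<lambda>\<omega>. real (num_representatives (<) V E (\<lambda>v. X v \<omega>)))"
    and "expectation (\<lambda>\<omega>. real (num_representatives (<) V E (\<lambda>v. X v \<omega>)))
      \<le> 3 / 4 * real (card V)"
proof -
  have X: "X v \<in> borel_measurable M" if "v \<in> V" for v
    using ind that by (auto simp: indep_vars_def)
  show int: "integrable M (\<lambda>\<omega>. real (num_representatives (<) V E (\<lambda>v. X v \<omega>)))"
    using num_representatives_le_card[OF G] measurable_num_representatives[OF G X]
    by (intro integrable_const_bound[where B = "real (card V)"]) auto
  obtain p where p: "\<And>v. v \<in> V \<Longrightarrow> p v \<in> V \<and> p v \<noteq> v \<and> p v \<in> closed_nbhd E v"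
    using ex_neighbour[OF G iso] by metis
  have prob_eq: "prob (X v -` S \<inter> space M) = measure lborel ({0..1} \<inter> S)"
    if "v \<in> V" "S \<in> sets borel" for v S
  proof -
    have "prob (X v -` S \<inter> space M) = measure (distr M borel (X v)) S"
      using that X by (simp add: measure_distr)
    then show ?thesis
      using that by (simp add: unif)
  qed
  have half: "{0..1} \<inter> {..<1/2} = {0..<1/2::real}" "{0..1} \<inter> {1/2..} = {1/2..1::real}"
    by auto
  have "expectation (\<lambda>\<omega>. real (num_representatives (<) V E (\<lambda>v. X v \<omega>)))
      \<le> 3 / 4 * real (card V)"
  proof (rule expectation_num_representatives_le[where P = "\<lambda>x. x < 1/2" and p = p])
    fix v assume v: "v \<in> V"
    have low_eq: "{\<omega> \<in> space M. X v \<omega> < 1/2} = X v -` {..<1/2} \<inter> space M"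
      by auto
    then show "{\<omega> \<in> space M. X v \<omega> < 1/2} \<in> events"
      using measurable_sets[OF X[OF v]] by simp
    have low: "prob {\<omega> \<in> space M. X v \<omega> < 1/2} = 1/2"
      unfolding low_eq using prob_eq[OF v, of "{..<1/2}"] by (simp add: half)
    have high: "prob (X w -` {1/2..} \<inter> space M) = 1/2" if "w \<in> V" for w
      using prob_eq[OF that, of "{1/2..}"] by (simp add: half)
    have "{\<omega> \<in> space M. \<not> X v \<omega> < 1/2 \<and> \<not> X (p v) \<omega> < 1/2}
      = (\<Inter>u\<in>{v, p v}. X u -` {1/2..} \<inter> space M)"
      by auto
    \<comment> \<open>Independence is used for this pair only; \<open>p v \<noteq> v\<close> makes
      the product have two factors.\<close>
    also have "prob \<dots> = (\<Prod>u\<in>{v, p v}. prob (X u -` {1/2..} \<inter> space M))"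
      using p[OF v] v by (intro indep_varsD[OF ind]) auto
    also have "\<dots> = 1/4"
      using p[OF v] v by (simp add: high eq_commute[of v])
    finally show "prob {\<omega> \<in> space M. X v \<omega> < 1/2}
      + prob {\<omega> \<in> space M. \<not> X v \<omega> < 1/2 \<and> \<not> X (p v) \<omega> < 1/2} \<le> 3/4"
      using low by simp
  qed (use G p int in \<open>auto simp: transp_def irreflp_def\<close>)
  then show "expectation (\<lambda>\<omega>. real (num_representatives (<) V E (\<lambda>v. X v \<omega>)))
      \<le> 3 / 4 * real (card V)" .
qed

section \<open>The finite fields method\<close>

text \<open>This provides a substitute for the median in an arbitrary finite linear order. The
  segment grows by moving the least remaining element into it.\<close>

lemma linear_order_on_ex_initial_segment:
  assumes lin: "linear_order_on A r" and fin: "finite A" and "k \<le> card A"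
  shows "\<exists>L\<subseteq>A. card L = k \<and> (\<forall>x\<in>L. \<forall>y\<in>A - L. (x, y) \<in> r \<and> x \<noteq> y)"
  using \<open>k \<le> card A\<close>
proof (induction k)
  case 0
  show ?case by (rule exI[of _ "{}"]) simp
next
  case (Suc k)
  then obtain L where L: "L \<subseteq> A" "card L = k" "\<forall>x\<in>L. \<forall>y\<in>A - L. (x, y) \<in> r \<and> x \<noteq> y"
    by auto
  have tr: "trans r" and anti: "antisym r" and tot: "total_on A r"
    using lin by (auto simp: order_on_defs)
  have finL: "finite L"
    using L fin finite_subset by blast
  have "A - L \<noteq> {}"
    using Suc.prems L by auto
  moreover have "transp_on (A - L) (\<lambda>x y. (x, y) \<in> r \<and> x \<noteq> y)"
    using tr anti by (auto simp: transp_on_def dest: transD antisymD)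
  moreover have "asymp_on (A - L) (\<lambda>x y. (x, y) \<in> r \<and> x \<noteq> y)"
    using anti by (auto simp: asymp_on_def dest: antisymD)
  ultimately obtain m where m: "m \<in> A - L" "\<forall>x\<in>A - L. x \<noteq> m \<longrightarrow> \<not> ((x, m) \<in> r \<and> x \<noteq> m)"
    using Finite_Set.bex_min_element[of "A - L" "\<lambda>x y. (x, y) \<in> r \<and> x \<noteq> y"] fin by blast
  \<comment> \<open>Totality upgrades the minimal element \<open>m\<close> to a least one.\<close>
  have "(m, y) \<in> r" if "y \<in> A - L" "y \<noteq> m" for y
    using m that tot by (auto simp: total_on_def)
  then show ?case
    using L m finL by (intro exI[of _ "insert m L"]) auto
qed

text \<open>Subtracting the two values eliminates \<open>b\<close> and leaves \<open>a\<close> times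
  the nonzero \<open>u \<ominus> v\<close>, which determines \<open>a\<close> and then
  \<open>b\<close>. This replaces pairwise independence: coefficient pairs can be counted through
  the value pairs they produce.\<close>

lemma (in field) inj_on_affine_pair:
  assumes u: "u \<in> carrier R" and v: "v \<in> carrier R" and "u \<noteq> v"
  shows "inj_on (\<lambda>(a, b). (a \<otimes> u \<oplus> b, a \<otimes> v \<oplus> b)) (carrier R \<times> carrier R)"
proof (rule inj_onI; clarify)
  fix a b a' b'
  assume c: "a \<in> carrier R" "b \<in> carrier R" "a' \<in> carrier R" "b' \<in> carrier R"
    and eq: "a \<otimes> u \<oplus> b = a' \<otimes> u \<oplus> b'" "a \<otimes> v \<oplus> b = a' \<otimes> v \<oplus> b'"
  have *: "x \<otimes> (u \<ominus> v) = (x \<otimes> u \<oplus> y) \<ominus> (x \<otimes> v \<oplus> y)"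
    if "x \<in> carrier R" "y \<in> carrier R" for x y
    using that u v by algebra
  have "a \<otimes> (u \<ominus> v) = a' \<otimes> (u \<ominus> v)"
    using *[of a b] *[of a' b'] c eq by simp
  moreover have "u = (u \<ominus> v) \<oplus> v"
    using u v by algebra
  then have "u \<ominus> v \<noteq> \<zero>"
    using v \<open>u \<noteq> v\<close> by auto
  ultimately have "a = a'"
    using c u v m_rcancel by (metis minus_closed)
  then show "a = a' \<and> b = b'"
    using c eq u by simp
qed

lemma pair_pmf_of_set:
  assumes "finite A" "A \<noteq> {}" "finite B" "B \<noteq> {}"
  shows "pair_pmf (pmf_of_set A) (pmf_of_set B) = pmf_of_set (A \<times> B)"
proof (rule pmf_eqI)
  fix x :: "'a \<times> 'b"
  show "pmf (pair_pmf (pmf_of_set A) (pmf_of_set B)) x = pmf (pmf_of_set (A \<times> B)) x"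
    using assms by (cases x) (simp add: pmf_pair indicator_def card_cartesian_product)
qed

text \<open>The coefficient pair is uniform on \<open>?S\<close>, so probabilities are counts
  divided by \<open>q * (q - 1)\<close>, where \<open>q\<close> is the size of the field. The low
  values form an initial segment of size \<open>q div 2\<close>.\<close>

lemma (in field) expectation_num_representatives_affine:
  assumes G: "finite_simple_graph V E" and iso: "no_isolated_vertices V E"
    and fin: "finite (carrier R)" and V: "V \<subseteq> carrier R"
    and lin: "linear_order_on (carrier R) r"
  shows "measure_pmf.expectation
      (pair_pmf (pmf_of_set (carrier R - {\<zero>})) (pmf_of_set (carrier R)))
      (\<lambda>(a, b). real (num_representatives (\<lambda>x y. (x, y) \<in> r \<and> x \<noteq> y) V E (\<lambda>v. a \<otimes> v \<oplus> b)))
    \<le> 3 / 4 * real (card V)"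
proof -
  let ?U = "carrier R - {\<zero>}" and ?q = "card (carrier R)"
  let ?S = "?U \<times> carrier R"
  let ?M = "pmf_of_set ?S"
  define X where "X v \<omega> = fst \<omega> \<otimes> v \<oplus> snd \<omega>" for v \<omega>
  have S: "finite ?S" "?S \<noteq> {}"
    using fin one_closed one_not_zero by auto
  have M: "pair_pmf (pmf_of_set ?U) (pmf_of_set (carrier R)) = ?M"
    using fin one_closed one_not_zero by (intro pair_pmf_of_set) auto
  have q2: "?q \<ge> 2"
    using card_mono[OF fin, of "{\<zero>, \<one>}"] by simp
  obtain L where L: "L \<subseteq> carrier R" "card L = ?q div 2"
      "\<forall>x\<in>L. \<forall>y\<in>carrier R - L. (x, y) \<in> r \<and> x \<noteq> y"
    using linear_order_on_ex_initial_segment[OF lin fin, of "?q div 2"] by auto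
  let ?l = "?q div 2" and ?h = "?q - ?q div 2"
  have finL: "finite L" and finH: "finite (carrier R - L)"
    using L fin finite_subset by auto
  have cH: "card (carrier R - L) = ?h"
    using L finL by (simp add: card_Diff_subset)
  obtain p where p: "\<And>v. v \<in> V \<Longrightarrow> p v \<in> V \<and> p v \<noteq> v \<and> p v \<in> closed_nbhd E v"
    using ex_neighbour[OF G iso] by metis
  have XU: "X v \<omega> \<in> carrier R" if "v \<in> V" "\<omega> \<in> ?S" for v \<omega>
    using that V by (auto simp: X_def)
  have bound: "measure ?M {\<omega>. X v \<omega> \<in> L} + measure ?M {\<omega>. X v \<omega> \<notin> L \<and> X (p v) \<omega> \<notin> L} \<le> 3/4"
    if v: "v \<in> V" for v
  proof -
    have vu: "v \<in> carrier R" "p v \<in> carrier R"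
      using v p[OF v] V by auto
    \<comment> \<open>Once the multiplier is known, the value at \<open>v\<close> determines the
      shift.\<close>
    have "inj_on (\<lambda>\<omega>. (fst \<omega>, X v \<omega>)) (?S \<inter> {\<omega>. X v \<omega> \<in> L})"
      using vu by (auto simp: inj_on_def X_def)
    moreover have "(\<lambda>\<omega>. (fst \<omega>, X v \<omega>)) ` (?S \<inter> {\<omega>. X v \<omega> \<in> L}) \<subseteq> ?U \<times> L"
      by auto
    ultimately have "card (?S \<inter> {\<omega>. X v \<omega> \<in> L}) \<le> card (?U \<times> L)"
      using fin finL by (intro card_inj_on_le) auto
    then have low: "card (?S \<inter> {\<omega>. X v \<omega> \<in> L}) \<le> (?q - 1) * ?l"
      using L by (simp add: card_cartesian_product)
    let ?B = "?S \<inter> {\<omega>. X v \<omega> \<notin> L \<and> X (p v) \<omega> \<notin> L}"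
    let ?H = "carrier R - L"
    have "inj_on (\<lambda>\<omega>. (X v \<omega>, X (p v) \<omega>)) (carrier R \<times> carrier R)"
      using inj_on_affine_pair[OF vu] p[OF v] by (auto simp: X_def case_prod_unfold)
    then have "inj_on (\<lambda>\<omega>. (X v \<omega>, X (p v) \<omega>)) ?B"
      by (rule inj_on_subset) auto
    \<comment> \<open>A nonzero multiplier keeps the two values distinct, so the image avoids the
      diagonal of \<open>?H \<times> ?H\<close>.\<close>
    moreover have "X v \<omega> \<noteq> X (p v) \<omega>" if "\<omega> \<in> ?S" for \<omega>
      using that vu p[OF v] by (auto simp: X_def m_lcancel)
    then have "(\<lambda>\<omega>. (X v \<omega>, X (p v) \<omega>)) ` ?B \<subseteq> ?H \<times> ?H - Id_on ?H"
      using XU[OF v] XU[OF conjunct1[OF p[OF v]]] by (fastforce simp: Id_on_def)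
    ultimately have "card ?B \<le> card (?H \<times> ?H - Id_on ?H)"
      using finH by (intro card_inj_on_le) auto
    also have "\<dots> = card (?H \<times> ?H) - card (Id_on ?H)"
      using finH by (intro card_Diff_subset) (auto simp: Id_on_def)
    also have "card (Id_on ?H) = card ?H"
      by (simp add: Id_on_def UNION_singleton_eq_range card_image inj_on_def)
    finally have high: "card ?B \<le> ?h * ?h - ?h"
      by (simp add: card_cartesian_product cH)
    \<comment> \<open>Removing the diagonal is essential: with \<open>?h * ?h\<close> alone the
      inequality fails for every \<open>?q \<ge> 2\<close>. The parity split resolves
      \<open>div\<close>, and writing \<open>k = Suc j\<close> resolves the truncated
      subtractions.\<close>
    have "4 * ((?q - 1) * ?l + (?h * ?h - ?h)) \<le> 3 * (?q * (?q - 1))"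
    proof (cases "even ?q")
      case True
      then obtain k where k: "?q = 2 * k" by blast
      with q2 obtain j where "k = Suc j" by (cases k) auto
      with k show ?thesis by (simp add: algebra_simps)
    next
      case False
      then obtain k where k: "?q = 2 * k + 1" using oddE by blast
      then show ?thesis by (simp add: algebra_simps)
    qed
    then have "4 * (card (?S \<inter> {\<omega>. X v \<omega> \<in> L}) + card ?B) \<le> 3 * card ?S"
      using low high by (simp add: card_cartesian_product mult.commute)
    moreover have "card ?S > 0"
      using S by (simp add: card_gt_0_iff)
    moreover have "real a / real c + real b / real c \<le> 3/4" if "4 * (a + b) \<le> 3 * c" "c > 0" for a b c
    proof -
      have "real (4 * (a + b)) \<le> real (3 * c)"
        using that by (simp only: of_nat_le_iff)
      then show ?thesis
        using that by (simp add: field_simps)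
    qed
    ultimately show ?thesis
      using S by (simp add: measure_pmf_of_set)
  qed
  have tr: "transp (\<lambda>x y. (x, y) \<in> r \<and> x \<noteq> y)"
    using lin by (auto simp: transp_def order_on_defs dest: transD antisymD)
  have "measure_pmf.expectation ?M
      (\<lambda>\<omega>. real (num_representatives (\<lambda>x y. (x, y) \<in> r \<and> x \<noteq> y) V E (\<lambda>v. X v \<omega>)))
    \<le> 3 / 4 * real (card V)"
  proof (rule measure_pmf.expectation_num_representatives_le[where P = "\<lambda>x. x \<in> L" and p = p])
    \<comment> \<open>The support of \<open>?M\<close> is \<open>?S\<close>; there all values lie in
      the carrier, where \<open>L\<close> precedes its complement.\<close>
    show "AE \<omega> in measure_pmf ?M. \<forall>u\<in>V. \<forall>v\<in>V.
        X u \<omega> \<in> L \<and> X v \<omega> \<notin> L \<longrightarrow> (X u \<omega>, X v \<omega>) \<in> r \<and> X u \<omega> \<noteq> X v \<omega>"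
      using S L(3) XU by (auto simp: AE_measure_pmf_iff simp del: mem_Sigma_iff)
    show "integrable (measure_pmf ?M)
        (\<lambda>\<omega>. real (num_representatives (\<lambda>x y. (x, y) \<in> r \<and> x \<noteq> y) V E (\<lambda>v. X v \<omega>)))"
      using S by (intro integrable_measure_pmf_finite) simp
  qed (use G p tr bound in \<open>auto simp: irreflp_def\<close>)
  then show ?thesis
    by (simp add: M X_def case_prod_unfold)
qed

theorem theorem1:
  fixes V :: "'a set" and E :: "'a set set"
    and M :: "'w measure" and X :: "'a \<Rightarrow> 'w \<Rightarrow> real"
    and F :: "('a, 'r) ring_scheme" and ord_F :: "'a rel"
  assumes "finite_simple_graph V E"
    and "no_isolated_vertices V E"
  shows
    "(prob_space M \<and>
      prob_space.indep_vars M (\<lambda>_. borel) X V \<and>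
      (\<forall>v\<in>V. distr M borel (X v) = uniform_measure lborel {0..1})
      \<longrightarrow>
      integrable M (\<lambda>\<omega>. real (num_representatives (<) V E (\<lambda>v. X v \<omega>))) \<and>
      prob_space.expectation M (\<lambda>\<omega>. real (num_representatives (<) V E (\<lambda>v. X v \<omega>)))
        \<le> 3 / 4 * real (card V))
     \<and>
     (field F \<and> finite (carrier F) \<and> V \<subseteq> carrier F \<and> linear_order_on (carrier F) ord_F
      \<longrightarrow>
      measure_pmf.expectation
        (pair_pmf (pmf_of_set (carrier F - {\<zero>\<^bsub>F\<^esub>})) (pmf_of_set (carrier F)))
        (\<lambda>(A, B). real (num_representatives (\<lambda>x y. (x, y) \<in> ord_F \<and> x \<noteq> y) V E
                          (\<lambda>v. A \<otimes>\<^bsub>F\<^esub> v \<oplus>\<^bsub>F\<^esub> B)))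
        \<le> 3 / 4 * real (card V))"
  using assms
  by (intro conjI impI prob_space.num_representatives_uniform_reals
      field.expectation_num_representatives_affine) auto

end
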